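(* Let $p$ be a prime number and let $n=p^{s}m$, where $m\geq 1$ is a natural number with $p\nmid m$ and $s\geq 0$ is an integer. If $G$ is a group of order $n$ and $p^{s}$ does not divide $\Gamma(m)$, then at least one of the following holds: (1) $O_{p}(G)\neq 1$; or (2) $G$ is not solvable.
   Context: For a finite group $G$ and a prime $p$, $O_{p}(G)$ denotes the $p$-core of $G$, that is, the largest normal $p$-subgroup of $G$. For natural numbers $t,q$, let $\gamma(t,q)=(q^{t}-1)(q^{t-1}-1)\cdots(q^{2}-1)(q-1)$. If $m=q_{1}^{t_{1}}q_{2}^{t_{2}}\cdots q_{k}^{t_{k}}$ is the prime factorization of $m$, with the primes $q_{i}$ pairwise distinct and $t_{i}>0$ for each $i$, let $\Gamma(m)=\gamma(t_{1},q_{1})\cdots\gamma(t_{k},q_{k})$ (so $\Gamma(1)=1$, the empty product). *)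

theory Defs
  imports
    "HOL-Algebra.Solvable_Groups"
    "HOL-Algebra.SndIsomorphismGrp"
    "HOL-Computational_Algebra.Primes"
begin

definition normal_p_subgroup :: "nat \<Rightarrow> 'a set \<Rightarrow> ('a, 'b) monoid_scheme \<Rightarrow> bool" where
  "normal_p_subgroup p H G \<longleftrightarrow> H \<lhd> G \<and> (\<exists>k. card H = p ^ k)"

text \<open>The \<open>p\<close>-core \<open>O\<^sub>p(G)\<close>. It is meaningful for a finite group \<open>G\<close> and a prime \<open>p\<close>;
  the lemma \<open>p_core_greatest\<close> below shows that the description then denotes.\<close>

definition p_core :: "nat \<Rightarrow> ('a, 'b) monoid_scheme \<Rightarrow> 'a set" where
  "p_core p G = (THE H. normal_p_subgroup p H G \<and> (\<forall>K. normal_p_subgroup p K G \<longrightarrow> K \<subseteq> H))"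

text \<open>The subtraction on \<open>nat\<close> is exact for \<open>q \<ge> 1\<close>; below, \<open>q\<close> is always prime.\<close>

definition small_gamma :: "nat \<Rightarrow> nat \<Rightarrow> nat" where
  "small_gamma t q = (\<Prod>i = 1..t. q ^ i - 1)"

definition big_gamma :: "nat \<Rightarrow> nat" where
  "big_gamma m = (\<Prod>q\<in>prime_factors m. small_gamma (multiplicity q m) q)"

lemma (in group) normal_p_subgroup_mult:
  assumes "finite (carrier G)" "prime p"
    and H: "normal_p_subgroup p H G" and K: "normal_p_subgroup p K G"
  shows "normal_p_subgroup p (H <#> K) G"
proof -
  obtain i j where i: "card H = p ^ i" and j: "card K = p ^ j"
    and HG: "H \<lhd> G" and KG: "K \<lhd> G"
    using H K by (auto simp: normal_p_subgroup_def)
  have sub: "subgroup K G" "subgroup H G"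
    using HG KG by (auto dest: normal_imp_subgroup)
  interpret second_isomorphism_grp H G K
    using HG sub by (simp add: second_isomorphism_grp_def second_isomorphism_grp_axioms_def)
  let ?HK = "G\<lparr>carrier := H <#> K\<rparr>" and ?K = "G\<lparr>carrier := K\<rparr>"
  have HK: "subgroup (H <#> K) G"
    by (rule normal_set_mult_subgroup)
  have "subgroup H ?HK"
    using HK H_contained_in_set_mult sub by (simp add: subgroup_incl)
  then have 1: "card (rcosets\<^bsub>?HK\<^esub> H) * card H = card (H <#> K)"
    using group.lagrange[OF subgroup_imp_group[OF HK]] by (simp add: order_def)
  have "subgroup (H \<inter> K) ?K"
    using sub by (simp add: subgroup_incl subgroups_Inter_pair)
  then have 2: "card (rcosets\<^bsub>?K\<^esub> (H \<inter> K)) * card (H \<inter> K) = card K"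
    using group.lagrange[OF subgroup_imp_group[OF sub(1)]] by (simp add: order_def)
  have "card (rcosets\<^bsub>?K\<^esub> (H \<inter> K)) = card (rcosets\<^bsub>?HK\<^esub> H)"
    using normal_intersection_quotient_isom
    by (auto simp: iso_def FactGroup_def dest: bij_betw_same_card)
  with 1 2 i j have "card (H <#> K) dvd p ^ j * p ^ i"
    by (metis dvd_triv_left mult_dvd_mono dvd_refl)
  then have "\<exists>k. card (H <#> K) = p ^ k"
    using divides_primepow_nat[OF \<open>prime p\<close>] by (metis power_add)
  then show ?thesis
    using normal_subgroup_set_mult_closed[OF HG KG] by (simp add: normal_p_subgroup_def)
qed

lemma (in group) p_core_greatest:
  assumes fin: "finite (carrier G)" and p: "prime p"
  shows "normal_p_subgroup p (p_core p G) G \<and>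
    (\<forall>K. normal_p_subgroup p K G \<longrightarrow> K \<subseteq> p_core p G)"
  unfolding p_core_def
proof (rule theI')
  have sub: "K \<subseteq> carrier G" if "normal_p_subgroup p K G" for K
    using that unfolding normal_p_subgroup_def by (elim conjE) (rule subgroup.subset[OF normal_imp_subgroup])
  have one: "normal_p_subgroup p {\<one>} G"
    unfolding normal_p_subgroup_def using one_is_normal by (intro conjI exI[of _ 0]) auto
  have bound: "\<forall>K. normal_p_subgroup p K G \<longrightarrow> card K < Suc (card (carrier G))"
    using sub fin by (simp add: card_mono less_Suc_eq_le)
  obtain H where H: "normal_p_subgroup p H G"
    and max: "\<And>K. normal_p_subgroup p K G \<Longrightarrow> card K \<le> card H"
    using ex_has_greatest_nat[OF one bound] by auto
  have "K \<subseteq> H" if K: "normal_p_subgroup p K G" for K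
  proof -
    interpret second_isomorphism_grp H G K
      using H K by (auto simp: normal_p_subgroup_def second_isomorphism_grp_def
          second_isomorphism_grp_axioms_def dest: normal_imp_subgroup)
    have HK: "normal_p_subgroup p (H <#> K) G"
      using fin p H K by (rule normal_p_subgroup_mult)
    have "finite (H <#> K)"
      using sub[OF HK] fin by (rule finite_subset)
    then have "H <#> K = H"
      using card_seteq[OF _ H_contained_in_set_mult max[OF HK]] by simp
    then show ?thesis
      using S_contained_in_set_mult by simp
  qed
  with H show "\<exists>!H. normal_p_subgroup p H G \<and> (\<forall>K. normal_p_subgroup p K G \<longrightarrow> K \<subseteq> H)"
    by (intro ex1I[of _ H]) (simp, blast)
qed

end

theory Submission
  imports
    Defs
    "HOL-Algebra.Sylow"
    "HOL-Algebra.Multiplicative_Group"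
    "HOL-Algebra.Group_Action"
begin

text \<open>Let \<open>G\<close> be solvable with \<open>O\<^sub>p(G) = 1\<close>, let \<open>P\<close> be a Sylow \<open>p\<close>-subgroup, and take a
  series of normal subgroups of \<open>G\<close> whose factors are abelian of prime power order. If a
  \<open>p\<close>-group acts on an abelian group of order \<open>q\<^sup>t\<close> with \<open>q \<noteq> p\<close>, then the quotient by the
  kernel has order dividing \<open>\<gamma>(t, q)\<close>: a suitable non-trivial \<open>x\<close> has an orbit of size dividing
  \<open>q\<^sup>t - 1\<close>, and its stabilizer acts on the quotient by \<open>\<langle>x\<rangle>\<close> with the same kernel. As
  \<open>\<gamma>(a, q) \<gamma>(b, q)\<close> divides \<open>\<gamma>(a + b, q)\<close>, the order of \<open>P\<close> divides \<open>\<Gamma>(m) |P \<inter> D|\<close>, where \<open>D\<close>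
  is the intersection of the centralizers of the factors of order prime to \<open>p\<close>. Going up the
  series, \<open>D\<close> meets every term in a \<open>p'\<close>-group that is centralized by the \<open>p\<close>-elements of \<open>D\<close>:
  a \<open>p\<close>-factor cannot contribute, since it would split off a non-trivial normal \<open>p\<close>-subgroup.
  Hence \<open>P \<inter> D = 1\<close>.\<close>

section \<open>Divisibility properties of gamma and Gamma\<close>

lemma small_gamma_0 [simp]: "small_gamma 0 q = 1"
  by (simp add: small_gamma_def)

lemma small_gamma_Suc: "small_gamma (Suc t) q = small_gamma t q * (q ^ Suc t - 1)"
  by (simp add: small_gamma_def)

text \<open>Splits the top factor of gamma(a + b, q) as in the q-analogue of Pascal's rule. With
  truncated subtraction it is also true for \<open>q = 0\<close>.\<close>

lemma power_add_minus_one: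
  fixes q :: nat
  shows "q ^ (a + b) - 1 = q ^ b * (q ^ a - 1) + (q ^ b - 1)"
proof (cases "q = 0")
  case False
  then have "1 \<le> q ^ b" "q ^ b \<le> q ^ b * q ^ a"
    by simp_all
  then show ?thesis
    by (simp add: power_add diff_mult_distrib2 mult.commute)
qed (cases a; cases b; simp)

text \<open>For q \<ge> 2 the quotient is a Gaussian binomial coefficient, and the proof is its
  Pascal rule cleared of denominators: of the two summands of gamma(a + b, q), one is a multiple of
  the product by lowering a, the other by lowering b.\<close>

lemma small_gamma_add_dvd: "small_gamma a q * small_gamma b q dvd small_gamma (a + b) q"
proof (induction "a + b" arbitrary: a b)
  case (Suc n)
  show ?case
  proof (cases "a = 0 \<or> b = 0")
    case False
    then obtain a' b' where ab: "a = Suc a'" "b = Suc b'"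
      using not0_implies_Suc by blast
    have n: "n = a' + b" "n = a + b'"
      using Suc.hyps(2) ab by auto
    have "small_gamma a' q * small_gamma b q dvd small_gamma n q"
      using Suc.hyps(1)[OF n(1)] n by simp
    then have 1: "small_gamma a q * small_gamma b q dvd small_gamma n q * (q ^ b * (q ^ a - 1))"
      unfolding ab(1) small_gamma_Suc by (auto elim!: dvdE)
    have "small_gamma a q * small_gamma b' q dvd small_gamma n q"
      using Suc.hyps(1)[OF n(2)] n by simp
    then have 2: "small_gamma a q * small_gamma b q dvd small_gamma n q * (q ^ b - 1)"
      unfolding ab(2) small_gamma_Suc by (auto elim!: dvdE)
    have "small_gamma (a + b) q = small_gamma n q * (q ^ (a + b) - 1)"
      using Suc.hyps(2) small_gamma_Suc[of n q] by simp
    also have "\<dots> = small_gamma n q * (q ^ b * (q ^ a - 1)) + small_gamma n q * (q ^ b - 1)"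
      by (simp only: power_add_minus_one distrib_left)
    finally show ?thesis
      using dvd_add[OF 1 2] by simp
  qed auto
qed simp

text \<open>Since t' \<le> t - 1, gamma(t', q) divides gamma(t - 1, q), and q^t - 1 is the one
  factor left. It later pays for an orbit together with the smaller section that remains.\<close>

lemma power_minus_one_dvd_small_gamma:
  assumes "t' < t"
  shows "(q ^ t - 1) * small_gamma t' q dvd small_gamma t q"
proof -
  obtain u where u: "t = Suc u" "t' \<le> u"
    using assms by (metis less_Suc_eq_le less_imp_Suc_add)
  have "small_gamma t' q dvd small_gamma t' q * small_gamma (u - t') q"
    by simp
  also have "\<dots> dvd small_gamma u q"
    using small_gamma_add_dvd[of t' q "u - t'"] u by simp
  finally show ?thesis
    unfolding u small_gamma_Suc by (simp only: mult.commute mult_dvd_mono dvd_refl)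
qed

lemma big_gamma_1 [simp]: "big_gamma (Suc 0) = 1"
  by (simp add: big_gamma_def)

text \<open>Only the factor at q changes, from gamma(v, q) to gamma(v + a, q) with v the exponent of
  q in m. This absorbs one more q-factor of the series.\<close>

lemma big_gamma_mult_prime_power_dvd:
  assumes q: "prime q" and m: "m > 0"
  shows "big_gamma m * small_gamma a q dvd big_gamma (m * q ^ a)"
proof -
  let ?F = "prime_factors m - {q}"
  \<comment> \<open>The factor at q can be split off even when q does not divide k, as it is then
    gamma(0, q) = 1.\<close>
  have split: "big_gamma k = small_gamma (multiplicity q k) q *
      (\<Prod>r\<in>prime_factors k - {q}. small_gamma (multiplicity r k) r)" for k
  proof (cases "q \<in> prime_factors k")
    case True
    then show ?thesis
      unfolding big_gamma_def by (simp add: prod.remove)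
  next
    case False
    then have "multiplicity q k = 0"
      using q prime_factors_multiplicity[of k] by auto
    then show ?thesis
      using False by (simp add: big_gamma_def)
  qed
  have F: "prime_factors (m * q ^ a) - {q} = ?F"
  proof -
    have "r dvd m * q ^ a \<longleftrightarrow> r dvd m" if "prime r" "r \<noteq> q" for r
      using that q by (metis dvd_mult2 prime_dvd_mult_iff prime_dvd_power primes_dvd_imp_eq)
    then show ?thesis
      using q m by (auto simp: in_prime_factors_iff prime_gt_0_nat)
  qed
  have eq: "multiplicity r (m * q ^ a) = multiplicity r m" if "r \<in> ?F" for r
  proof -
    have "prime r" "r \<noteq> q" using that by auto
    then have "multiplicity r (q ^ a) = 0"
      using q by (simp add: multiplicity_distinct_prime_power)
    then show ?thesis
      using m q \<open>prime r\<close> by (simp add: prime_elem_multiplicity_mult_distrib)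
  qed
  have "multiplicity q (m * q ^ a) = multiplicity q m + a"
    using q m by (simp add: prime_elem_multiplicity_mult_distrib)
  then have "big_gamma (m * q ^ a) = small_gamma (multiplicity q m + a) q *
      (\<Prod>r\<in>?F. small_gamma (multiplicity r m) r)"
    unfolding split[of "m * q ^ a"] F by (simp add: eq)
  then show ?thesis
    unfolding split[of m] using small_gamma_add_dvd[of "multiplicity q m" q a]
    by (auto elim!: dvdE)
qed

text \<open>For n = 1 the exponent 0 serves, whatever q is. Otherwise some prime divides n, it must
  be q, and the cofactor left after removing all powers of q has no prime divisor.\<close>

lemma only_prime_factor_imp_power:
  assumes "n > 0" "\<And>r :: nat. prime r \<Longrightarrow> r dvd n \<Longrightarrow> r = q"
  shows "\<exists>a. n = q ^ a"
proof (cases "n = 1")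
  case False
  then obtain r where "prime r" "r dvd n"
    using prime_factor_nat by blast
  then have q: "prime q" "q dvd n"
    using assms(2) by auto
  obtain k where k: "n = q ^ multiplicity q n * k" "\<not> q dvd k"
    using multiplicity_decompose'[of n q] q assms(1) by (metis less_irrefl not_prime_unit)
  have "k = 1"
  proof (rule ccontr)
    assume "k \<noteq> 1"
    then obtain r where "prime r" "r dvd k"
      using prime_factor_nat by blast
    then show False
      using assms(2) k by (metis dvd_mult)
  qed
  with k show ?thesis by auto
qed (auto intro: exI[of _ 0])

section \<open>Commutator identities, coprime powers and Cauchy's theorem\<close>

context group begin

lemma inv_cancel_left:
  assumes "x \<in> carrier G" "y \<in> carrier G"
  shows "x \<otimes> (inv x \<otimes> y) = y" "inv x \<otimes> (x \<otimes> y) = y"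
  using assms by (simp_all flip: m_assoc)

abbreviation commutator :: "'a \<Rightarrow> 'a \<Rightarrow> 'a"
  where "commutator g x \<equiv> g \<otimes> x \<otimes> inv g \<otimes> inv x"

text \<open>Together with the default simplification rules these bring words into right-nested
  reduced form, which settles the identities below.\<close>

lemmas group_word = m_assoc inv_mult_group inv_cancel_left

lemma commutator_mult_right:
  assumes "g \<in> carrier G" "x \<in> carrier G" "y \<in> carrier G"
  shows "commutator g (x \<otimes> y) = commutator g x \<otimes> (x \<otimes> commutator g y \<otimes> inv x)"
  using assms by (simp add: group_word)

lemma commutator_mult_left:
  assumes "g \<in> carrier G" "h \<in> carrier G" "x \<in> carrier G"
  shows "commutator (g \<otimes> h) x = (g \<otimes> commutator h x \<otimes> inv g) \<otimes> commutator g x"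
  using assms by (simp add: group_word)

lemma commutator_inv_right:
  assumes "g \<in> carrier G" "x \<in> carrier G"
  shows "commutator g (inv x) = inv x \<otimes> inv (commutator g x) \<otimes> inv (inv x)"
  using assms by (simp add: group_word)

lemma commutator_inv_left:
  assumes "g \<in> carrier G" "x \<in> carrier G"
  shows "commutator (inv g) x = inv g \<otimes> inv (commutator g x) \<otimes> inv (inv g)"
  using assms by (simp add: group_word)

lemma commutator_conj:
  assumes "k \<in> carrier G" "g \<in> carrier G" "x \<in> carrier G"
  shows "commutator (k \<otimes> g \<otimes> inv k) x =
    k \<otimes> commutator g (inv k \<otimes> x \<otimes> inv (inv k)) \<otimes> inv k"
  using assms by (simp add: group_word)

lemma commutator_eq_one_iff:
  assumes "g \<in> carrier G" "x \<in> carrier G"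
  shows "commutator g x = \<one> \<longleftrightarrow> g \<otimes> x = x \<otimes> g"
proof -
  have "commutator g x \<otimes> (x \<otimes> g) = g \<otimes> x"
    using assms by (simp add: group_word)
  then show ?thesis
    using assms r_cancel_one[of "x \<otimes> g" "commutator g x"] by simp
qed

text \<open>With u m + v n = 1 by Bezout, x is a product of integer powers of x^m and x^n.\<close>

lemma pow_coprime_mem:
  assumes A: "subgroup A G" and x: "x \<in> carrier G"
    and "x [^] (m::nat) \<in> A" "x [^] (n::nat) \<in> A" "coprime m n"
  shows "x \<in> A"
proof -
  obtain u v where uv: "u * int m + v * int n = 1"
    using bezout_int[of "int m" "int n"] assms(5) by auto
  have "x [^] (int m * u) \<in> A" "x [^] (int n * v) \<in> A"
    using assms by (simp_all add: int_pow_pow[symmetric] int_pow_int subgroup_int_pow_closed)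
  then have "x [^] (int m * u) \<otimes> x [^] (int n * v) \<in> A"
    using A by (simp add: subgroup.m_closed)
  then have "x [^] (int m * u + int n * v) \<in> A"
    using x by (simp add: int_pow_mult)
  then show ?thesis
    using uv x by (simp add: mult.commute)
qed

lemma subgroup_pow_card_eq_one:
  assumes S: "subgroup S G" and g: "g \<in> S"
  shows "g [^] card S = \<one>"
proof -
  have "g [^]\<^bsub>G\<lparr>carrier := S\<rparr>\<^esub> order (G\<lparr>carrier := S\<rparr>) = \<one>"
    using group.pow_order_eq_1[OF subgroup_imp_group[OF S], of g] g by simp
  then show ?thesis
    by (simp add: order_def nat_pow_def)
qed

lemma eq_one_of_coprime_pow:
  assumes "x \<in> carrier G" "x [^] (m::nat) = \<one>" "x [^] (n::nat) = \<one>" "coprime m n"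
  shows "x = \<one>"
  using pow_coprime_mem[OF triv_subgroup assms(1), of m n] assms by simp

lemma conj_pow:
  assumes "g \<in> carrier G" "x \<in> carrier G"
  shows "(g \<otimes> x \<otimes> inv g) [^] (n::nat) = g \<otimes> x [^] n \<otimes> inv g"
  using assms by (induction n) (simp_all add: group_word)

text \<open>Sylow's theorem for the exponent 1, where the cofactor k may still contain p, yields a
  subgroup of order p; any of its elements other than one will do.\<close>

lemma cauchy:
  assumes fin: "finite (carrier G)" and p: "prime p" "p dvd order G"
  obtains x where "x \<in> carrier G" "x \<noteq> \<one>" "x [^] p = \<one>"
proof -
  obtain k where "order G = p ^ 1 * k"
    using p by auto
  then obtain H where H: "subgroup H G" "card H = p"
    using sylow_thm[OF p(1) is_group _ fin, of 1 k] by auto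
  have "p > 1" using p(1) by (rule prime_gt_1_nat)
  then have "H \<noteq> {\<one>}" using H by auto
  then obtain x where x: "x \<in> H" "x \<noteq> \<one>"
    using subgroup.one_closed[OF H(1)] by blast
  then have "x [^] p = \<one>"
    using subgroup_pow_card_eq_one[OF H(1)] H(2) by blast
  with x that show thesis
    using subgroup.mem_carrier[OF H(1)] by blast
qed

end

section \<open>Powers and Cauchy's theorem modulo a normal subgroup\<close>

context normal begin

lemma order_FactGroup_mult: "order (G Mod H) * card H = order G"
  using lagrange[OF subgroup_axioms] by (simp add: order_def FactGroup_def)

text \<open>N is the order of the quotient, and N-th powers are trivial there. It is given by an
  equation of cardinalities so that later uses need not mention the quotient.\<close>

lemma pow_index_mem:
  assumes fin: "finite (carrier G)" and x: "x \<in> carrier G" and N: "order G = N * card H"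
  shows "x [^] N \<in> H"
proof -
  have "card H > 0"
    using fin by (rule finite_imp_card_positive)
  then have N': "N = order (G Mod H)"
    using N order_FactGroup_mult by (metis mult_cancel2 neq0_conv)
  have "H #> x \<in> carrier (G Mod H)"
    using x by (simp add: carrier_FactGroup)
  then have "(H #> x) [^]\<^bsub>G Mod H\<^esub> N = H"
    unfolding N' using group.pow_order_eq_1[OF factorgroup_is_group] by simp
  then have "H #> x [^] N = H"
    using FactGroup_pow[OF x] by simp
  then show ?thesis
    using x rcos_self[OF _ subgroup_axioms] by (metis nat_pow_closed)
qed

text \<open>Cauchy's theorem in the quotient, lifted to a coset representative.\<close>

lemma cauchy_index:
  assumes fin: "finite (carrier G)" and q: "prime q" "q dvd N" and N: "order G = N * card H"
  obtains x where "x \<in> carrier G" "x \<notin> H" "x [^] q \<in> H"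
proof -
  have "card H > 0"
    using fin by (rule finite_imp_card_positive)
  then have N': "N = order (G Mod H)"
    using N order_FactGroup_mult by (metis mult_cancel2 neq0_conv)
  interpret Q: group "G Mod H"
    by (rule factorgroup_is_group)
  have "finite (carrier (G Mod H))"
    using fin by (simp add: carrier_FactGroup)
  then obtain X where X: "X \<in> carrier (G Mod H)" "X \<noteq> H" "X [^]\<^bsub>G Mod H\<^esub> q = H"
    using Q.cauchy[OF _ q(1)] q(2) N' by auto
  then obtain x where x: "x \<in> carrier G" "X = H #> x"
    by (auto simp: carrier_FactGroup)
  have "x \<notin> H"
    using X(2) x rcos_const[OF is_group] by auto
  moreover have "H #> x [^] q = H"
    using X(3) x FactGroup_pow by simp
  then have "x [^] q \<in> H"
    using x rcos_self[OF _ subgroup_axioms] by (metis nat_pow_closed)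
  ultimately show thesis
    using that x by blast
qed

text \<open>If a prime r other than q divided the index, some x outside H would have x^r in H; as
  x^(q^a) is in H too, coprimality would put x into H.\<close>

lemma index_prime_power:
  assumes fin: "finite (carrier G)" and q: "prime q"
    and ex: "\<And>x. x \<in> carrier G \<Longrightarrow> x [^] (q ^ a) \<in> H"
  shows "\<exists>c. order G = q ^ c * card H"
proof -
  define N where "N = order (G Mod H)"
  have N: "order G = N * card H"
    by (simp add: N_def order_FactGroup_mult)
  have "N > 0"
    using N fin by (metis gr0I mult_0 order_gt_0_iff_finite less_irrefl)
  moreover have "r = q" if r: "prime r" "r dvd N" for r
  proof (rule ccontr)
    assume "r \<noteq> q"
    then have "coprime r (q ^ a)"
      using q r by (simp add: primes_coprime)
    then show False
      using cauchy_index[OF fin r N] ex pow_coprime_mem[OF subgroup_axioms] by metis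
  qed
  ultimately show ?thesis
    using only_prime_factor_imp_power N by metis
qed

end

section \<open>Orbit sizes of a p-group\<close>

text \<open>All orbits have p-power size. Let p^c be the exact power of p dividing |F|: if no orbit
  size divided |F|, each would be a multiple of p^(c+1), and so would |F|, which the orbits
  partition.\<close>

lemma (in group_action) exists_orbit_card_dvd:
  assumes p: "prime p" "order G = p ^ k"
    and E: "F \<subseteq> E" "finite F" "F \<noteq> {}"
    and inv: "\<And>g x. g \<in> carrier G \<Longrightarrow> x \<in> F \<Longrightarrow> \<phi> g x \<in> F"
  obtains x where "x \<in> F" "card (orbit G \<phi> x) dvd card F"
proof (rule ccontr)
  assume "\<not> thesis"
  then have ndvd: "\<not> card (orbit G \<phi> x) dvd card F" if "x \<in> F" for x
    using that \<open>\<And>x. x \<in> F \<Longrightarrow> card (orbit G \<phi> x) dvd card F \<Longrightarrow> thesis\<close> by blast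
  define c where "c = multiplicity p (card F)"
  define C where "C = orbit G \<phi> ` F"
  have sub: "orbit G \<phi> x \<subseteq> F" if "x \<in> F" for x
    using inv that by (auto simp: orbit_def)
  have union: "\<Union>C = F"
    using sub orbit_refl E(1) by (fastforce simp: C_def)
  have "p ^ Suc c dvd card X" if "X \<in> C" for X
  proof -
    obtain x where x: "x \<in> F" "X = orbit G \<phi> x"
      using \<open>X \<in> C\<close> by (auto simp: C_def)
    then have "card X dvd p ^ k"
      using orbit_stabilizer_theorem[of x] E(1) p(2) by (metis dvd_triv_left subsetD)
    then obtain b where b: "card X = p ^ b"
      using divides_primepow_nat[OF p(1)] by blast
    have "\<not> b \<le> c"
    proof
      assume "b \<le> c"
      then have "p ^ b dvd card F"
        unfolding c_def by (rule multiplicity_dvd')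
      then show False
        using ndvd[OF x(1)] x(2) b by simp
    qed
    then show ?thesis
      unfolding b by (intro le_imp_power_dvd) simp
  qed
  moreover have "X = Y" if "X \<in> C" "Y \<in> C" "z \<in> X" "z \<in> Y" for X Y z
  proof -
    have *: "orbit G \<phi> x = orbit G \<phi> z" if "x \<in> F" "z \<in> orbit G \<phi> x" for x
    proof -
      have F: "w \<in> E" if "w \<in> orbit G \<phi> x" for w
        using that sub \<open>x \<in> F\<close> E(1) by blast
      have x: "x \<in> E" and z: "z \<in> E"
        using \<open>x \<in> F\<close> E(1) F that by auto
      have xz: "x \<in> orbit G \<phi> z"
        using x z that(2) by (rule orbit_sym)
      have "z \<in> F"
        using sub that by blast
      then have F': "w \<in> E" if "w \<in> orbit G \<phi> z" for w
        using that sub E(1) by blast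
      show ?thesis
        using orbit_trans[OF z x F xz] orbit_trans[OF x z F' that(2)] by blast
    qed
    show ?thesis
      using that * by (auto simp: C_def)
  qed
  ultimately have "p ^ Suc c dvd card (\<Union>C)"
    using E(2) union by (intro dvd_partition) (auto simp: pairwise_def disjnt_def)
  then have "p ^ Suc c dvd card F"
    by (simp only: union)
  moreover have "card F \<noteq> 0" "\<not> is_unit p"
    using E p by auto
  ultimately show False
    unfolding c_def using power_dvd_iff_le_multiplicity[of "card F" p "Suc c"] by (simp add: c_def)
qed

section \<open>Centralizers of sections and coprime action\<close>

context group begin

text \<open>Only an inclusion, and R may be any set, even \<open>{g}\<close>. Equality of N with its
  conjugate by g needs the inverse too, hence \<open>{g, inv g}\<close> in places.\<close>

definition normalizes :: "'a set \<Rightarrow> 'a set \<Rightarrow> bool"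
  where "normalizes R N \<longleftrightarrow> (\<forall>g\<in>R. \<forall>x\<in>N. g \<otimes> x \<otimes> inv g \<in> N)"

text \<open>The kernel of the conjugation action of R on the section B/A, phrased by commutators so
  that no quotient has to be formed.\<close>

definition section_centralizer :: "'a set \<Rightarrow> 'a set \<Rightarrow> 'a set \<Rightarrow> 'a set"
  where "section_centralizer R B A = {g \<in> R. \<forall>x\<in>B. commutator g x \<in> A}"

lemma normalizesD: "normalizes R N \<Longrightarrow> g \<in> R \<Longrightarrow> x \<in> N \<Longrightarrow> g \<otimes> x \<otimes> inv g \<in> N"
  by (simp add: normalizes_def)

lemma normalizes_subset: "normalizes R N \<Longrightarrow> S \<subseteq> R \<Longrightarrow> normalizes S N"
  by (auto simp: normalizes_def)

lemma normal_iff_normalizes: "N \<lhd> G \<longleftrightarrow> subgroup N G \<and> normalizes (carrier G) N"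
  by (simp add: normal_inv_iff normalizes_def)

lemma normal_in_subgroupI:
  assumes "subgroup A G" "subgroup B G" "A \<subseteq> B" "normalizes B A"
  shows "A \<lhd> G\<lparr>carrier := B\<rparr>"
proof -
  interpret B: group "G\<lparr>carrier := B\<rparr>"
    using assms(2) by (rule subgroup_imp_group)
  show ?thesis
    unfolding B.normal_inv_iff using assms
    by (simp add: subgroup_incl normalizes_def flip: m_inv_consistent)
qed

lemma subgroup_card_dvd:
  assumes "subgroup A G" "subgroup B G" "A \<subseteq> B"
  shows "card A dvd card B"
proof -
  have "card (rcosets\<^bsub>G\<lparr>carrier := B\<rparr>\<^esub> A) * card A = card B"
    using group.lagrange[OF subgroup_imp_group[OF assms(2)] subgroup_incl[OF assms]]
    by (simp add: order_def)
  then show ?thesis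
    by (metis dvd_triv_right)
qed

text \<open>The commutator identities in the left argument express [g h, x] and [g^-1, x] through
  elements of A and their conjugates under R.\<close>

lemma subgroup_section_centralizer:
  assumes R: "subgroup R G" and A: "subgroup A G" and B: "B \<subseteq> carrier G" and RA: "normalizes R A"
  shows "subgroup (section_centralizer R B A) G"
proof (rule subgroupI)
  show "section_centralizer R B A \<subseteq> carrier G"
    using subgroup.subset[OF R] by (auto simp: section_centralizer_def)
  have "commutator \<one> x = \<one>" if "x \<in> B" for x
    using B that by (auto simp: commutator_eq_one_iff)
  then have "\<one> \<in> section_centralizer R B A"
    using subgroup.one_closed[OF R] subgroup.one_closed[OF A] by (auto simp: section_centralizer_def)
  then show "section_centralizer R B A \<noteq> {}"
    by blast
next
  fix g assume g: "g \<in> section_centralizer R B A"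
  then have "g \<in> carrier G" "inv g \<in> R"
    using subgroup.m_inv_closed[OF R] subgroup.mem_carrier[OF R] by (auto simp: section_centralizer_def)
  have "commutator (inv g) x \<in> A" if "x \<in> B" for x
  proof (subst commutator_inv_left)
    show "inv g \<otimes> inv (commutator g x) \<otimes> inv (inv g) \<in> A"
      using g that \<open>inv g \<in> R\<close>
      by (intro normalizesD[OF RA] subgroup.m_inv_closed[OF A]) (simp_all add: section_centralizer_def)
  qed (use that B \<open>g \<in> carrier G\<close> in auto)
  with \<open>inv g \<in> R\<close> show "inv g \<in> section_centralizer R B A"
    by (simp add: section_centralizer_def)
next
  fix g h assume *: "g \<in> section_centralizer R B A" "h \<in> section_centralizer R B A"
  then have "g \<in> carrier G" "h \<in> carrier G" "g \<otimes> h \<in> R"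
    using subgroup.m_closed[OF R] subgroup.mem_carrier[OF R] by (auto simp: section_centralizer_def)
  moreover have "(g \<otimes> commutator h x \<otimes> inv g) \<otimes> commutator g x \<in> A" if "x \<in> B" for x
    using * that normalizesD[OF RA] subgroup.m_closed[OF A]
    by (auto simp: section_centralizer_def)
  ultimately show "g \<otimes> h \<in> section_centralizer R B A"
    using B by (auto simp: section_centralizer_def commutator_mult_left)
qed

text \<open>These are the elements of B whose cosets modulo A are fixed by g. Being a subgroup, the
  set contains a generated subgroup once it contains the generators.\<close>

lemma subgroup_commutator_mem:
  assumes A: "subgroup A G" and B: "subgroup B G" and BA: "normalizes B A" and g: "g \<in> carrier G"
  shows "subgroup {x \<in> B. commutator g x \<in> A} G"
proof (rule subgroupI)
  show "{x \<in> B. commutator g x \<in> A} \<subseteq> carrier G"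
    using subgroup.subset[OF B] by auto
  have "\<one> \<in> {x \<in> B. commutator g x \<in> A}"
    using g subgroup.one_closed[OF A] subgroup.one_closed[OF B] by simp
  then show "{x \<in> B. commutator g x \<in> A} \<noteq> {}"
    by blast
next
  fix x assume "x \<in> {x \<in> B. commutator g x \<in> A}"
  then have x: "x \<in> B" "x \<in> carrier G" "inv x \<in> B" "commutator g x \<in> A"
    using subgroup.m_inv_closed[OF B] subgroup.mem_carrier[OF B] by auto
  then have "inv x \<otimes> inv (commutator g x) \<otimes> inv (inv x) \<in> A"
    by (intro normalizesD[OF BA] subgroup.m_inv_closed[OF A])
  then show "inv x \<in> {x \<in> B. commutator g x \<in> A}"
    using x g commutator_inv_right[of g x] by simp
next
  fix x y assume "x \<in> {x \<in> B. commutator g x \<in> A}" "y \<in> {x \<in> B. commutator g x \<in> A}"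
  then have xy: "x \<in> B" "x \<in> carrier G" "y \<in> carrier G" "x \<otimes> y \<in> B" "commutator g x \<in> A" "commutator g y \<in> A"
    using subgroup.m_closed[OF B] subgroup.mem_carrier[OF B] by auto
  then have "commutator g x \<otimes> (x \<otimes> commutator g y \<otimes> inv x) \<in> A"
    by (intro subgroup.m_closed[OF A xy(5)] normalizesD[OF BA xy(1) xy(6)])
  then show "x \<otimes> y \<in> {x \<in> B. commutator g x \<in> A}"
    using xy g commutator_mult_right[of g x y] by simp
qed

text \<open>Since \<open>g\<close> fixes \<open>M/A\<close> pointwise, \<open>g\<^sup>k y g\<^sup>-\<^sup>k \<in> A h\<^sup>k y\<close> for \<open>h = [g, y] \<in> M\<close>;
  so the order of \<open>g\<close> kills \<open>h\<close> modulo \<open>A\<close>.\<close>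

lemma commutator_mem_of_coprime:
  assumes A: "subgroup A G" and M: "subgroup M G"
    and g: "g \<in> carrier G" "g [^] (l::nat) = \<one>" and y: "y \<in> carrier G"
    and gA: "normalizes {g} A" and gM: "\<And>x. x \<in> M \<Longrightarrow> commutator g x \<in> A"
    and gy: "commutator g y \<in> M"
    and N: "commutator g y [^] (N::nat) \<in> A" "coprime l N"
  shows "commutator g y \<in> A"
proof -
  let ?h = "commutator g y"
  have h: "?h \<in> carrier G" using g y by simp
  have "\<exists>a\<in>A. commutator (g [^] k) y = a \<otimes> ?h [^] k" for k :: nat
  proof (induction k)
    case 0
    show ?case
      using y subgroup.one_closed[OF A] by (intro bexI[of _ \<one>]) simp_all
  next
    case (Suc k)
    then obtain a where a: "a \<in> A" "commutator (g [^] k) y = a \<otimes> ?h [^] k"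
      by blast
    have aG: "a \<in> carrier G"
      using A a(1) by (rule subgroup.mem_carrier)
    have "?h [^] k \<in> M"
      by (induction k) (simp_all add: gy subgroup.one_closed[OF M] subgroup.m_closed[OF M])
    \<comment> \<open>The part collected on the left stays in A: the conjugate of a because g
      normalizes A, and [g, h^k] because h^k lies in M, on which g acts trivially modulo A.\<close>
    then have mem: "(g \<otimes> a \<otimes> inv g) \<otimes> commutator g (?h [^] k) \<in> A"
      using a(1) gA gM by (metis insertI1 normalizesD subgroup.m_closed[OF A])
    have "g [^] Suc k = g \<otimes> g [^] k"
      using g(1) by (rule nat_pow_Suc2)
    then have "commutator (g [^] Suc k) y = (g \<otimes> (a \<otimes> ?h [^] k) \<otimes> inv g) \<otimes> ?h"
      using g y a(2) commutator_mult_left[of g "g [^] k" y] by (simp del: nat_pow_Suc)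
    also have "\<dots> = ((g \<otimes> a \<otimes> inv g) \<otimes> commutator g (?h [^] k)) \<otimes> (?h [^] k \<otimes> ?h)"
    proof -
      have "g \<otimes> (a \<otimes> u) \<otimes> inv g \<otimes> v = ((g \<otimes> a \<otimes> inv g) \<otimes> commutator g u) \<otimes> (u \<otimes> v)"
        if "u \<in> carrier G" "v \<in> carrier G" for u v
        using that g aG by (simp add: group_word)
      then show ?thesis using h by blast
    qed
    finally show ?case
      using mem by (intro bexI[of _ "(g \<otimes> a \<otimes> inv g) \<otimes> commutator g (?h [^] k)"]) simp_all
  qed
  from this[of l] obtain a where a: "a \<in> A" "\<one> = a \<otimes> ?h [^] l"
    using g y by auto
  then have "inv (?h [^] l) = a"
    using h subgroup.mem_carrier[OF A] by (intro inv_equality) simp_all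
  then have "?h [^] l = inv a"
    using h by (metis inv_inv nat_pow_closed)
  then have "?h [^] l \<in> A"
    using a(1) A by (simp add: subgroup.m_inv_closed)
  then show ?thesis
    using pow_coprime_mem[OF A h _ N(1) N(2)] by blast
qed

section \<open>A p-group acting on the cosets of a section\<close>

text \<open>The inverse of g serves for the reverse inclusion, where a in A has to be written as the
  conjugate by g of an element of A.\<close>

lemma conj_coset:
  assumes A: "subgroup A G" and g: "g \<in> carrier G" and gA: "normalizes {g, inv g} A"
    and x: "x \<in> carrier G"
  shows "g <# (A #> x) #> inv g = A #> (g \<otimes> x \<otimes> inv g)"
proof -
  have "g \<otimes> (a \<otimes> x) \<otimes> inv g \<in> A #> (g \<otimes> x \<otimes> inv g)" if a: "a \<in> A" for a
  proof -
    have "a \<in> carrier G" using A a by (rule subgroup.mem_carrier)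
    then have "g \<otimes> (a \<otimes> x) \<otimes> inv g = (g \<otimes> a \<otimes> inv g) \<otimes> (g \<otimes> x \<otimes> inv g)"
      using g x by (simp add: group_word)
    moreover have "g \<otimes> a \<otimes> inv g \<in> A"
      using gA a by (simp add: normalizes_def)
    ultimately show ?thesis
      by (auto simp: r_coset_def)
  qed
  moreover have "\<exists>b\<in>A. a \<otimes> (g \<otimes> x \<otimes> inv g) = g \<otimes> (b \<otimes> x) \<otimes> inv g" if a: "a \<in> A" for a
  proof (rule bexI)
    have "a \<in> carrier G" using A a by (rule subgroup.mem_carrier)
    then show "a \<otimes> (g \<otimes> x \<otimes> inv g) = g \<otimes> ((inv g \<otimes> a \<otimes> inv (inv g)) \<otimes> x) \<otimes> inv g"
      using g x by (simp add: group_word)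
    show "inv g \<otimes> a \<otimes> inv (inv g) \<in> A"
      using gA a by (simp add: normalizes_def)
  qed
  ultimately show ?thesis
    by (auto simp: l_coset_def r_coset_def)
qed

lemma normalizes_of_commutator:
  assumes A: "subgroup A G" and B: "B \<subseteq> carrier G"
    and "\<And>x y. x \<in> B \<Longrightarrow> y \<in> A \<Longrightarrow> commutator x y \<in> A"
  shows "normalizes B A"
  unfolding normalizes_def
proof (intro ballI)
  fix x y assume xy: "x \<in> B" "y \<in> A"
  then have "x \<in> carrier G" "y \<in> carrier G"
    using B subgroup.mem_carrier[OF A] by auto
  then have "commutator x y \<otimes> y = x \<otimes> y \<otimes> inv x"
    by (simp add: group_word)
  then show "x \<otimes> y \<otimes> inv x \<in> A"
    using subgroup.m_closed[OF A assms(3)[OF xy] xy(2)] by simp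
qed

lemma card_rcosets_subgroup:
  assumes A: "subgroup A G" and B: "subgroup B G" and "A \<subseteq> B" and fin: "finite B"
    and card: "card B = N * card A"
  shows "card ((\<lambda>x. A #> x) ` B) = N"
proof -
  have "(\<lambda>x. A #> x) ` B = rcosets\<^bsub>G\<lparr>carrier := B\<rparr>\<^esub> A"
    by (auto simp: RCOSETS_def)
  moreover have "card (rcosets\<^bsub>G\<lparr>carrier := B\<rparr>\<^esub> A) * card A = card B"
    using group.lagrange[OF subgroup_imp_group[OF B] subgroup_incl[OF A B \<open>A \<subseteq> B\<close>]]
    by (simp add: order_def)
  moreover have "card A > 0"
    using subgroup.one_closed[OF A] \<open>A \<subseteq> B\<close> fin by (auto simp: card_gt_0_iff dest: finite_subset)
  ultimately show ?thesis
    using card by simp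
qed

text \<open>The p-group R permutes the N - 1 non-trivial cosets of A in B. Some orbit has size
  dividing N - 1; S is the stabilizer of a coset A x in it, and the orbit-stabilizer theorem gives
  the divisibility.\<close>

lemma card_section_fixed_point:
  assumes fin: "finite (carrier G)" and p: "prime p"
    and A: "subgroup A G" and B: "subgroup B G" and AB: "A \<subseteq> B"
    and card: "card B = N * card A" "N > 1"
    and R: "subgroup R G" "card R = p ^ k" and RA: "normalizes R A" and RB: "normalizes R B"
  obtains x S where "x \<in> B" "x \<notin> A" "subgroup S G" "S \<subseteq> R"
    "\<And>g. g \<in> S \<Longrightarrow> commutator g x \<in> A" "card R dvd (N - 1) * card S"
proof -
  let ?R = "G\<lparr>carrier := R\<rparr>"
  define \<phi> where "\<phi> = (\<lambda>g. \<lambda>H \<in> {H. H \<subseteq> carrier G}. g <# H #> (inv g))"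
  \<comment> \<open>Conjugation on all subsets of G, restricted to R; a coset is a single point of
    this action.\<close>
  interpret act: group_action ?R "{H. H \<subseteq> carrier G}" \<phi>
    unfolding \<phi>_def
    by (rule group_action.induced_action[OF action_by_conjugation_on_power_set R(1)])
  note AG = subgroup.subset[OF A] and BG = subgroup.subset[OF B] and RG = subgroup.subset[OF R(1)]
  have finB: "finite B" using BG fin by (rule finite_subset)
  have coset_A: "A #> x = A \<longleftrightarrow> x \<in> A" if "x \<in> B" for x
    using that BG coset_join1[of A x] coset_join2[of x A] A by auto
  define F where "F = (\<lambda>x. A #> x) ` B - {A}"
  have \<phi>: "\<phi> g (A #> x) = A #> (g \<otimes> x \<otimes> inv g)" if "g \<in> R" "x \<in> B" for g x
  proof -
    have "normalizes {g, inv g} A"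
      using RA that(1) subgroup.m_inv_closed[OF R(1)] by (auto intro: normalizes_subset)
    moreover have "A #> x \<subseteq> carrier G"
      using that BG AG r_coset_subset_G by blast
    ultimately show ?thesis
      using that RG BG conj_coset[OF A, of g x] by (simp add: \<phi>_def subset_eq)
  qed
  have inB: "g \<otimes> x \<otimes> inv g \<in> B" if "g \<in> R" "x \<in> B" for g x
    using normalizesD[OF RB that] .
  \<comment> \<open>Conjugating back shows that no non-trivial coset is sent to A, so
    \<open>F\<close> is invariant.\<close>
  have conj_A: "x \<in> A" if "g \<in> R" "x \<in> B" "g \<otimes> x \<otimes> inv g \<in> A" for g x
  proof -
    have "inv g \<otimes> (g \<otimes> x \<otimes> inv g) \<otimes> inv (inv g) \<in> A"
      using RA subgroup.m_inv_closed[OF R(1) that(1)] that(3) by (rule normalizesD)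
    moreover have "g \<in> carrier G" "x \<in> carrier G" using that RG BG by auto
    ultimately show ?thesis by (simp add: group_word)
  qed
  have card_F: "card F = N - 1"
  proof -
    have "A \<in> (\<lambda>x. A #> x) ` B"
      using coset_A subgroup.one_closed[OF A] subgroup.one_closed[OF B] by (metis imageI)
    then show ?thesis
      using card_rcosets_subgroup[OF A B AB finB card(1)] finB by (simp add: F_def)
  qed
  then have F: "F \<noteq> {}"
    using card(2) by auto
  have F': "F \<subseteq> {H. H \<subseteq> carrier G}" "finite F"
    using finB BG r_coset_subset_G[OF AG] unfolding F_def by blast+
  have inv: "\<phi> g X \<in> F" if g: "g \<in> carrier ?R" and X: "X \<in> F" for g X
  proof -
    obtain x where x: "x \<in> B" "x \<notin> A" "X = A #> x"
      using X coset_A by (auto simp: F_def)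
    have gR: "g \<in> R" using g by simp
    have "g \<otimes> x \<otimes> inv g \<notin> A"
      using conj_A[OF gR x(1)] x(2) by blast
    then show ?thesis
      using x(3) \<phi>[OF gR x(1)] inB[OF gR x(1)] coset_A[OF inB[OF gR x(1)]] by (simp add: F_def)
  qed
  obtain X where X: "X \<in> F" "card (orbit ?R \<phi> X) dvd N - 1"
    unfolding card_F[symmetric]
    by (rule act.exists_orbit_card_dvd[OF p _ F' F inv, of k]) (simp_all add: order_def R(2))
  then obtain x where x: "x \<in> B" "x \<notin> A" "X = A #> x"
    using coset_A by (auto simp: F_def)
  define S where "S = stabilizer ?R \<phi> X"
  have XG: "X \<in> {H. H \<subseteq> carrier G}"
    using x BG AG r_coset_subset_G by blast
  have "subgroup S ?R"
    unfolding S_def using XG by (rule act.stabilizer_subgroup)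
  then have "subgroup S G" "S \<subseteq> R"
    using incl_subgroup[OF R(1)] subgroup.subset by fastforce+
  moreover have "commutator g x \<in> A" if "g \<in> S" for g
  proof -
    have g: "g \<in> R" "A #> (g \<otimes> x \<otimes> inv g) = A #> x"
      using that \<phi> x by (auto simp: S_def stabilizer_def)
    have xG: "x \<in> carrier G" "g \<in> carrier G" using x BG g RG by auto
    have "g \<otimes> x \<otimes> inv g \<in> A #> (g \<otimes> x \<otimes> inv g)"
      using xG A by (intro rcos_self) auto
    then obtain a where "a \<in> A" "g \<otimes> x \<otimes> inv g = a \<otimes> x"
      unfolding g(2) by (auto simp: r_coset_def)
    then show ?thesis
      using xG subgroup.mem_carrier[OF A, of a] by (simp add: m_assoc)
  qed
  moreover have "card R dvd (N - 1) * card S"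
    using act.orbit_stabilizer_theorem[OF XG] X(2)
    by (simp add: S_def order_def) (metis dvd_refl mult_dvd_mono)
  ultimately show thesis
    using that x by blast
qed

text \<open>Some \<open>x \<in> B - A\<close> has a stabilizer \<open>S\<close> modulo \<open>A\<close> whose index in \<open>R\<close> divides
  \<open>q\<^sup>t - 1\<close>, and \<open>S\<close> acts on \<open>B/\<langle>A, x\<rangle>\<close> with the same kernel as on \<open>B/A\<close>.\<close>

lemma card_dvd_section_centralizer_small_gamma:
  assumes fin: "finite (carrier G)" and p: "prime p" and q: "prime q" and pq: "p \<noteq> q"
    and B: "subgroup B G"
    and A: "subgroup A G" "A \<subseteq> B" "\<And>x y. x \<in> B \<Longrightarrow> y \<in> B \<Longrightarrow> commutator x y \<in> A"
    and card: "card B = q ^ t * card A"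
    and R: "subgroup R G" "card R = p ^ k" "normalizes R A" "normalizes R B"
  shows "card R dvd card (section_centralizer R B A) * small_gamma t q"
  using A card R
\<comment> \<open>B stays fixed while A grows to A' and R shrinks to S, so k varies along with
  t.\<close>
proof (induction t arbitrary: A R k rule: less_induct)
  case (less t)
  note A = less.prems(1-3) and card = less.prems(4) and R = less.prems(5-8)
  note BG = subgroup.subset[OF B] and RG = subgroup.subset[OF R(1)]
  have finB: "finite B" using BG fin by (rule finite_subset)
  have BA: "normalizes B A"
    using A BG by (intro normalizes_of_commutator) auto
  have card_A: "card A > 0"
    using finB A(2) subgroup.one_closed[OF A(1)] by (auto simp: card_gt_0_iff dest: finite_subset)
  show ?case
  proof (cases "t = 0")
    case True
    then have "A = B"
      using A(2) finB card by (intro card_subset_eq) auto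
    have "section_centralizer R B A = R"
      using normalizesD[OF R(4)] subgroup.m_closed[OF B] subgroup.m_inv_closed[OF B]
      by (auto simp: section_centralizer_def \<open>A = B\<close>)
    then show ?thesis
      by simp
  next
    case False
    then have "q ^ t > 1"
      using prime_gt_1_nat[OF q] by (intro one_less_power) simp_all
    then obtain x S where x: "x \<in> B" "x \<notin> A" and S: "subgroup S G" "S \<subseteq> R"
      and Sx: "\<And>g. g \<in> S \<Longrightarrow> commutator g x \<in> A" and RS: "card R dvd (q ^ t - 1) * card S"
      using card_section_fixed_point[OF fin p A(1) B A(2) card _ R] by metis
    define A' where "A' = generate G (insert x A)"
    have xG: "insert x A \<subseteq> carrier G" using x A(2) BG by auto
    have A': "subgroup A' G" "A \<subseteq> A'" "x \<in> A'" "A' \<subseteq> B"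
      unfolding A'_def using xG A(2) x(1) B generate_subgroup_incl[of "insert x A" B]
      by (auto intro: generate_is_subgroup generate.incl)
    have fixed: "commutator g y \<in> A" if g: "g \<in> S" and y: "y \<in> A'" for g y
    proof -
      have gG: "g \<in> carrier G" using g S RG by auto
      have "commutator g a \<in> A" if "a \<in> A" for a
        using normalizesD[OF R(3), of g a] g S(2) that subgroup.m_closed[OF A(1)]
          subgroup.m_inv_closed[OF A(1)] by blast
      \<comment> \<open>The elements fixed by g modulo A form a subgroup containing x and A, hence
        all of A'.\<close>
      then have "insert x A \<subseteq> {y \<in> B. commutator g y \<in> A}"
        using x(1) A(2) Sx[OF g] by auto
      then have "A' \<subseteq> {y \<in> B. commutator g y \<in> A}"
        unfolding A'_def using subgroup_commutator_mem[OF A(1) B BA gG]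
        by (rule generate_subgroup_incl)
      then show ?thesis using y by blast
    qed
    have SA': "normalizes S A'"
      using A' S RG fixed by (intro normalizes_of_commutator) auto
    have SA: "normalizes S A" and SB: "normalizes S B"
      using R(3,4) S(2) by (auto intro: normalizes_subset)
    have "card A' dvd card B" "card A dvd card A'"
      using A' A(1) B by (auto intro: subgroup_card_dvd)
    \<comment> \<open>Both indices u = [B : A'] and v = [A' : A] turn out to be powers of q. As x is
      not in A, v is not 1, so the exponent t' of u is below t.\<close>
    then obtain u v where uv: "card B = u * card A'" "card A' = v * card A"
      by (metis dvdE mult.commute)
    then have "q ^ t = u * v"
      using card card_A by simp
    then have "u dvd q ^ t" "v dvd q ^ t"
      by auto
    then obtain t' c where t'c: "u = q ^ t'" "v = q ^ c"
      using divides_primepow_nat[OF q] by blast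
    have "A' \<noteq> A" using A'(3) x(2) by blast
    then have "c \<noteq> 0"
      using uv(2) t'c(2) A'(2,4) finB card_subset_eq[of A' A] by (auto dest: finite_subset)
    moreover have "t = t' + c"
      using \<open>q ^ t = u * v\<close> t'c q by (metis power_add power_inject_exp prime_gt_1_nat)
    ultimately have "t' < t" by simp
    obtain k' where k': "card S = p ^ k'"
      using subgroup_card_dvd[OF S(1) R(1) S(2)] divides_primepow_nat[OF p] R(2) by metis
    have "card S dvd card (section_centralizer S B A') * small_gamma t' q"
    proof (rule less.IH[OF \<open>t' < t\<close> A'(1) A'(4) _ _ S(1) k' SA' SB])
      show "commutator x y \<in> A'" if "x \<in> B" "y \<in> B" for x y
        using A(3)[OF that] A'(2) by blast
    qed (simp add: uv(1) t'c(1))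
    \<comment> \<open>Coprime action: a p-element that acts trivially on A'/A and on B/A' acts
      trivially on B/A. So the kernel for the smaller section lies in the old one.\<close>
    moreover have "card (section_centralizer S B A') dvd card (section_centralizer R B A)"
    proof (intro subgroup_card_dvd subgroup_section_centralizer S(1) A'(1) BG SA' R(1) A(1) R(3) subsetI)
      fix g assume g: "g \<in> section_centralizer S B A'"
      then have gS: "g \<in> S" and gB: "\<And>y. y \<in> B \<Longrightarrow> commutator g y \<in> A'"
        by (auto simp: section_centralizer_def)
      have gG: "g \<in> carrier G" using gS S RG by auto
      have gS1: "g [^] (p ^ k') = \<one>"
        using subgroup_pow_card_eq_one[OF S(1) gS] k' by simp
      have "commutator g y \<in> A" if y: "y \<in> B" for y
      proof (rule commutator_mem_of_coprime[OF A(1) A'(1) gG gS1])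
        show "y \<in> carrier G" using y BG by auto
        show "normalizes {g} A" using SA gS by (auto intro: normalizes_subset)
        show "commutator g y \<in> A'" using gB[OF y] .
        have "card A' = q ^ c * card A" using uv t'c by simp
        moreover have AA': "A \<lhd> G\<lparr>carrier := A'\<rparr>"
          using A(1) A' BA by (intro normal_in_subgroupI) (auto intro: normalizes_subset)
        ultimately have "commutator g y [^]\<^bsub>G\<lparr>carrier := A'\<rparr>\<^esub> (q ^ c) \<in> A"
          using gB[OF y] A'(4) finB
          by (intro normal.pow_index_mem[OF AA']) (auto simp: order_def dest: finite_subset)
        then show "commutator g y [^] (q ^ c) \<in> A"
          by (simp add: nat_pow_def)
        show "coprime (p ^ k') (q ^ c)"
          using p q pq by (simp add: primes_coprime)
      qed (use fixed gS in blast)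
      then show "g \<in> section_centralizer R B A"
        using gS S(2) by (auto simp: section_centralizer_def)
    qed
    ultimately have "card S dvd card (section_centralizer R B A) * small_gamma t' q"
      by (meson dvd_refl dvd_trans mult_dvd_mono)
    \<comment> \<open>The orbit contributes q^t - 1 and the induction gamma(t', q); together they
      divide gamma(t, q).\<close>
    then have "card R dvd (q ^ t - 1) * (card (section_centralizer R B A) * small_gamma t' q)"
      using RS by (meson dvd_refl dvd_trans mult_dvd_mono)
    also have "\<dots> dvd card (section_centralizer R B A) * small_gamma t q"
      using mult_dvd_mono[OF dvd_refl power_minus_one_dvd_small_gamma[OF \<open>t' < t\<close>]]
      by (metis mult.left_commute)
    finally show ?thesis .
  qed
qed

section \<open>Normal series of a solvable group and the effect of its p-factors\<close>

text \<open>In an abelian section the n-th power map is a homomorphism modulo A. It makes the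
  elements of exponent q modulo K a subgroup below.\<close>

lemma pow_mult_mod:
  assumes A: "subgroup A G" and B: "subgroup B G" and BA: "normalizes B A"
    and comm: "\<And>x y. x \<in> B \<Longrightarrow> y \<in> B \<Longrightarrow> commutator x y \<in> A"
    and x: "x \<in> B" and y: "y \<in> B"
  shows "\<exists>a\<in>A. (x \<otimes> y) [^] (n::nat) = a \<otimes> (x [^] n \<otimes> y [^] n)"
proof (induction n)
  case 0
  then show ?case
    using subgroup.one_closed[OF A] by (intro bexI[of _ \<one>]) simp_all
next
  case (Suc n)
  then obtain a where a: "a \<in> A" "(x \<otimes> y) [^] n = a \<otimes> (x [^] n \<otimes> y [^] n)"
    by blast
  have pow: "z [^] n \<in> B" if "z \<in> B" for z
    using that B by (induction n) (simp_all add: subgroup.one_closed subgroup.m_closed)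
  let ?c = "commutator (y [^] n) x"
  have carr: "x \<in> carrier G" "y \<in> carrier G" "a \<in> carrier G"
    using x y a(1) A B by (auto intro: subgroup.mem_carrier)
  \<comment> \<open>Moving x to the left of y^n costs the commutator [y^n, x], which is then
    conjugated by x^n to reach A.\<close>
  have "a \<otimes> (u \<otimes> v) \<otimes> (x \<otimes> y) = (a \<otimes> (u \<otimes> commutator v x \<otimes> inv u)) \<otimes> ((u \<otimes> x) \<otimes> (v \<otimes> y))"
    if "u \<in> carrier G" "v \<in> carrier G" for u v
    using carr that by (simp add: group_word)
  then have "(x \<otimes> y) [^] Suc n =
      (a \<otimes> (x [^] n \<otimes> ?c \<otimes> inv (x [^] n))) \<otimes> (x [^] Suc n \<otimes> y [^] Suc n)"
    using carr by (simp add: a(2))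
  moreover have "a \<otimes> (x [^] n \<otimes> ?c \<otimes> inv (x [^] n)) \<in> A"
    by (intro subgroup.m_closed[OF A a(1)] normalizesD[OF BA] pow comm x y)
  ultimately show ?case
    by blast
qed

text \<open>Conjugating the left argument of a commutator by k amounts to conjugating the right
  argument by k^-1 and the result by k; H and K are invariant under both.\<close>

lemma normal_section_centralizer:
  assumes D: "D \<lhd> G" and H: "H \<lhd> G" and K: "K \<lhd> G"
  shows "section_centralizer D H K \<lhd> G"
  unfolding normal_inv_iff
proof (intro conjI ballI)
  have DG: "D \<subseteq> carrier G" and HG: "H \<subseteq> carrier G"
    using D H by (auto intro: subgroup.mem_carrier normal_imp_subgroup)
  show "subgroup (section_centralizer D H K) G"
    using D H K DG HG
    by (intro subgroup_section_centralizer) (auto simp: normal_iff_normalizes intro: normalizes_subset)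
  fix k g assume k: "k \<in> carrier G" and g: "g \<in> section_centralizer D H K"
  then have gD: "g \<in> D" "g \<in> carrier G" using DG by (auto simp: section_centralizer_def)
  have "commutator (k \<otimes> g \<otimes> inv k) x \<in> K" if x: "x \<in> H" for x
  proof -
    have "inv k \<otimes> x \<otimes> inv (inv k) \<in> H"
      using k x H by (intro normal_invE(2)) auto
    then have "commutator g (inv k \<otimes> x \<otimes> inv (inv k)) \<in> K"
      using g by (simp add: section_centralizer_def)
    then have "k \<otimes> commutator g (inv k \<otimes> x \<otimes> inv (inv k)) \<otimes> inv k \<in> K"
      using K k by (intro normal_invE(2)) auto
    moreover have "x \<in> carrier G" using x HG by auto
    ultimately show ?thesis
      using commutator_conj[OF k gD(2)] by simp
  qed
  moreover have "k \<otimes> g \<otimes> inv k \<in> D"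
    using D k gD by (intro normal_invE(2)) auto
  ultimately show "k \<otimes> g \<otimes> inv k \<in> section_centralizer D H K"
    by (simp add: section_centralizer_def)
qed

text \<open>A subgroup equal to its derived subgroup would lie in every term of the derived series
  of G, by monotonicity.\<close>

lemma solvable_derived_neq:
  assumes "solvable G" and H: "subgroup H G" "H \<noteq> {\<one>}"
  shows "derived G H \<noteq> H"
proof
  assume eq: "derived G H = H"
  obtain n where n: "(derived G ^^ n) (carrier G) = {\<one>}"
    using assms(1) solvable_iff_trivial_derived_seq by blast
  have "H \<subseteq> (derived G ^^ i) (carrier G)" for i
  proof (induction i)
    case (Suc i)
    then show ?case
      using mono_derived[of H "(derived G ^^ i) (carrier G)"] eq by simp
  qed (use subgroup.subset[OF H(1)] in simp)
  then show False
    using n H subgroup.one_closed[OF H(1)] by (metis empty_iff subset_singletonD)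
qed

text \<open>Choose K maximal among the normal subgroups of G that contain the derived subgroup of H
  and lie properly in H. For a prime q dividing |H/K|, the elements of the abelian group H/K killed
  by q form a non-trivial G-invariant subgroup, which is everything by maximality.\<close>

lemma solvable_obtain_abelian_prime_power_section:
  assumes fin: "finite (carrier G)" and "solvable G" and H: "H \<lhd> G" "H \<noteq> {\<one>}"
  obtains K q a where "K \<lhd> G" "K \<subset> H" "prime q" "card H = q ^ a * card K"
    "\<And>x y. x \<in> H \<Longrightarrow> y \<in> H \<Longrightarrow> commutator x y \<in> K"
proof -
  have Hs: "subgroup H G" using H(1) by (rule normal_imp_subgroup)
  note HG = subgroup.subset[OF Hs]
  have finH: "finite H" using HG fin by (rule finite_subset)
  define \<K> where "\<K> = {K. K \<lhd> G \<and> derived G H \<subseteq> K \<and> K \<subset> H}"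
  have "derived G H \<subset> H"
    using derived_incl[OF subset_refl Hs] solvable_derived_neq[OF assms(2) Hs H(2)] by blast
  then have "derived G H \<in> \<K>"
    using derived_is_normal[OF H(1)] by (simp add: \<K>_def)
  moreover have "finite \<K>"
    using finH by (rule_tac finite_subset[of _ "Pow H"]) (auto simp: \<K>_def)
  ultimately obtain K where K: "K \<in> \<K>" and max: "\<And>L. L \<in> \<K> \<Longrightarrow> K \<subseteq> L \<Longrightarrow> K = L"
    using finite_has_maximal[of \<K>] by (metis empty_iff)
  have Kn: "K \<lhd> G" and Ks: "subgroup K G" and KH: "K \<subset> H" and dK: "derived G H \<subseteq> K"
    using K by (auto simp: \<K>_def normal_imp_subgroup)
  have comm: "commutator x y \<in> K" if "x \<in> H" "y \<in> H" for x y
  proof -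
    have "commutator x y \<in> derived G H"
      unfolding derived_def using that by (intro generate.incl) blast
    then show ?thesis using dK by blast
  qed
  have HK: "normalizes H K"
    using Kn HG by (auto simp: normal_iff_normalizes intro: normalizes_subset)
  interpret KH: normal K "G\<lparr>carrier := H\<rparr>"
    using Ks Hs KH HK by (intro normal_in_subgroupI) auto
  obtain N where N: "card H = N * card K"
    using subgroup_card_dvd[OF Ks Hs] KH by (metis dvdE mult.commute psubsetE)
  have "N \<noteq> 1"
    using N KH finH psubset_card_mono by (metis less_irrefl nat_mult_1)
  then obtain q where q: "prime q" "q dvd N"
    using prime_factor_nat by blast
  obtain z where z: "z \<in> H" "z \<notin> K" "z [^] q \<in> K"
    using KH.cauchy_index[OF _ q, of thesis] finH N by (auto simp: order_def nat_pow_def)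
  define L where "L = {x \<in> H. x [^] q \<in> K}"
  have "L \<lhd> G"
    unfolding normal_inv_iff
  proof (intro conjI ballI subgroupI)
    show "L \<subseteq> carrier G" "L \<noteq> {}"
      using HG z by (auto simp: L_def)
  next
    fix x assume "x \<in> L"
    then show "inv x \<in> L"
      using HG subgroup.m_inv_closed[OF Hs] subgroup.m_inv_closed[OF Ks]
      by (auto simp: L_def nat_pow_inv)
  next
    fix x y assume xy: "x \<in> L" "y \<in> L"
    then have "\<exists>a\<in>K. (x \<otimes> y) [^] q = a \<otimes> (x [^] q \<otimes> y [^] q)"
      by (intro pow_mult_mod[OF Ks Hs HK comm]) (simp_all add: L_def)
    then obtain a where "a \<in> K" "(x \<otimes> y) [^] q = a \<otimes> (x [^] q \<otimes> y [^] q)"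
      by blast
    then show "x \<otimes> y \<in> L"
      using xy subgroup.m_closed[OF Hs] subgroup.m_closed[OF Ks] by (simp add: L_def)
  next
    fix g x assume g: "g \<in> carrier G" and x: "x \<in> L"
    then show "g \<otimes> x \<otimes> inv g \<in> L"
      using HG normal_invE(2)[OF H(1) g] normal_invE(2)[OF Kn g]
      by (auto simp: L_def conj_pow)
  qed
  moreover have "K \<subseteq> L"
  proof
    fix x assume "x \<in> K"
    moreover from this have "x [^] n \<in> K" for n :: nat
      using Ks by (induction n) (simp_all add: subgroup.one_closed subgroup.m_closed)
    ultimately show "x \<in> L"
      using KH by (auto simp: L_def)
  qed
  moreover have "K \<noteq> L"
    using z by (auto simp: L_def)
  \<comment> \<open>L is normal in G and properly contains K; were it smaller than H, it would
    contradict maximality.\<close>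
  ultimately have "L = H"
    using max[of L] dK by (auto simp: \<K>_def L_def)
  then have "\<exists>c. card H = q ^ c * card K"
    using KH.index_prime_power[of q 1] finH q(1) by (auto simp: order_def L_def nat_pow_def)
  with that Kn KH q(1) comm show thesis by blast
qed

text \<open>A Sylow \<open>p\<close>-subgroup of \<open>D \<inter> H\<close> is a direct factor with complement \<open>D \<inter> K\<close>,
  so it consists of all \<open>p\<close>-elements of \<open>D \<inter> H\<close>, and is normal in \<open>G\<close>.\<close>

lemma Int_eq_Int_of_p_power_index:
  assumes fin: "finite (carrier G)" and p: "prime p"
    and triv: "\<And>S. normal_p_subgroup p S G \<Longrightarrow> S = {\<one>}"
    and D: "D \<lhd> G" and H: "H \<lhd> G" and K: "K \<lhd> G" "K \<subseteq> H" "card H = p ^ a * card K"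
    and ndvd: "\<not> p dvd card (D \<inter> K)"
    and comm: "\<And>g x e. g \<in> D \<Longrightarrow> g [^] (p ^ e :: nat) = \<one> \<Longrightarrow> x \<in> D \<inter> K \<Longrightarrow> g \<otimes> x = x \<otimes> g"
  shows "D \<inter> H = D \<inter> K"
proof -
  let ?L = "D \<inter> H" and ?M = "D \<inter> K"
  have Ln: "?L \<lhd> G" and Mn: "?M \<lhd> G"
    using D H K(1) by (auto intro: normal_subgroup_intersect)
  have Ls: "subgroup ?L G" and Ms: "subgroup ?M G" and Hs: "subgroup H G" and Ks: "subgroup K G"
    using Ln Mn H K(1) by (auto intro: normal_imp_subgroup)
  have LM: "?M \<subseteq> ?L" using K(2) by blast
  note LG = subgroup.subset[OF Ls] and HG = subgroup.subset[OF Hs]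
  have finL: "finite ?L" and finH: "finite H"
    using LG HG fin by (auto intro: finite_subset)
  interpret L: group "G\<lparr>carrier := ?L\<rparr>"
    using Ls by (rule subgroup_imp_group)
  interpret LM: normal ?M "G\<lparr>carrier := ?L\<rparr>"
    using Ms Ls LM Mn LG by (intro normal_in_subgroupI) (auto simp: normal_iff_normalizes intro: normalizes_subset)
  interpret KH: normal K "G\<lparr>carrier := H\<rparr>"
    using Ks Hs K HG by (intro normal_in_subgroupI) (auto simp: normal_iff_normalizes intro: normalizes_subset)
  \<comment> \<open>Powers of x stay in D, and H/K has order p^a; hence D \<inter> K has p-power
    index in D \<inter> H.\<close>
  have "x [^] (p ^ a) \<in> ?M" if x: "x \<in> ?L" for x
  proof -
    have "x [^] n \<in> D" for n :: nat
      using x subgroup.one_closed[OF normal_imp_subgroup[OF D]] subgroup.m_closed[OF normal_imp_subgroup[OF D]]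
      by (induction n) simp_all
    moreover have "x [^] (p ^ a) \<in> K"
      using KH.pow_index_mem[of x "p ^ a"] x finH K(3) by (simp add: order_def nat_pow_def)
    ultimately show ?thesis by simp
  qed
  then have "\<exists>c. card ?L = p ^ c * card ?M"
    using LM.index_prime_power[of p a] finL p by (auto simp: order_def nat_pow_def)
  then obtain c where c: "card ?L = p ^ c * card ?M"
    by blast
  \<comment> \<open>Since p does not divide |D \<inter> K|, the order p^c makes S a full Sylow
    p-subgroup of D \<inter> H.\<close>
  obtain S where S': "subgroup S (G\<lparr>carrier := ?L\<rparr>)" and card_S: "card S = p ^ c"
    using sylow_thm[OF p L.is_group, of c "card ?M"] finL c by (auto simp: order_def)
  have S: "subgroup S G" "S \<subseteq> ?L"
    using incl_subgroup[OF Ls S'] subgroup.subset[OF S'] by auto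
  have SG: "S \<subseteq> carrier G" and MG: "?M \<subseteq> carrier G"
    using S(2) LG LM by auto
  have M1: "x = \<one>" if "x \<in> ?M" "x [^] (p ^ c) = \<one>" for x
  proof (rule eq_one_of_coprime_pow[of _ "p ^ c" "card ?M"])
    show "x [^] card ?M = \<one>"
      using Ms that(1) by (rule subgroup_pow_card_eq_one)
    show "coprime (p ^ c) (card ?M)"
      using p ndvd by (simp add: prime_imp_coprime)
  qed (use that MG in auto)
  have S1: "s [^] (p ^ c) = \<one>" if "s \<in> S" for s
    using subgroup_pow_card_eq_one[OF S(1) that] card_S by simp
  \<comment> \<open>Multiplication S x (D \<inter> K) \<rightarrow> D \<inter> H is injective, as
    the two subgroups have coprime orders, and surjective by counting.\<close>
  define f where "f = (\<lambda>(s, m). s \<otimes> m)"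
  have "inj_on f (S \<times> ?M)"
  proof (intro inj_onI, clarify)
    fix s m t n
    assume mem: "s \<in> S" "t \<in> S" "m \<in> D" "m \<in> K" "n \<in> D" "n \<in> K" and eq: "f (s, m) = f (t, n)"
    have carr: "s \<in> carrier G" "t \<in> carrier G" "m \<in> carrier G" "n \<in> carrier G"
      using mem SG MG by auto
    then have "inv t \<otimes> s = n \<otimes> inv m"
      using eq by (simp add: f_def) (metis inv_closed inv_solve_left inv_solve_right m_assoc m_closed)
    moreover have "inv t \<otimes> s \<in> S"
      using S(1) mem by (simp add: subgroup.m_closed subgroup.m_inv_closed)
    moreover have "n \<otimes> inv m \<in> ?M"
      using subgroup.m_closed[OF Ms] subgroup.m_inv_closed[OF Ms] mem by blast
    ultimately have "n \<otimes> inv m = \<one>"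
      using M1 S1 by metis
    then have "n = m"
      using carr by (metis inv_closed inv_equality inv_inv)
    then show "s = t \<and> m = n"
      using eq carr by (simp add: f_def)
  qed
  then have "card (f ` (S \<times> ?M)) = card ?L"
    by (simp add: card_image card_cartesian_product card_S c)
  moreover have "f ` (S \<times> ?M) \<subseteq> ?L"
  proof
    fix y assume "y \<in> f ` (S \<times> ?M)"
    then obtain s m where "s \<in> S" "m \<in> ?M" "y = s \<otimes> m"
      by (auto simp: f_def)
    then show "y \<in> ?L"
      using subgroup.m_closed[OF Ls] S(2) LM by blast
  qed
  ultimately have SM: "f ` (S \<times> ?M) = ?L"
    using finL by (intro card_subset_eq) auto
  \<comment> \<open>Write y = s m. The p-element s commutes with m, so y^(p^c) = 1 forces m^(p^c) =
    1 and m = 1. Thus S is the set of all elements of D \<inter> H killed by p^c, a description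
    invariant under conjugation.\<close>
  have "y \<in> S" if y: "y \<in> ?L" "y [^] (p ^ c) = \<one>" for y
  proof -
    have "y \<in> f ` (S \<times> ?M)"
      unfolding SM by (rule y(1))
    then obtain s m where sm: "s \<in> S" "m \<in> ?M" "y = s \<otimes> m"
      by (auto simp: f_def)
    have carr: "s \<in> carrier G" "m \<in> carrier G" using sm SG MG by auto
    have "s \<otimes> m = m \<otimes> s"
      using comm[OF _ S1[OF sm(1)] sm(2)] S(2) sm(1) by blast
    then have "y [^] (p ^ c) = s [^] (p ^ c) \<otimes> m [^] (p ^ c)"
      unfolding sm(3) using carr by (intro pow_mult_distrib)
    then have "m [^] (p ^ c) = \<one>"
      using y(2) S1[OF sm(1)] carr by simp
    then show ?thesis
      using M1[OF sm(2)] sm carr by simp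
  qed
  moreover have "g \<otimes> s \<otimes> inv g \<in> ?L" "(g \<otimes> s \<otimes> inv g) [^] (p ^ c) = \<one>"
    if "g \<in> carrier G" "s \<in> S" for g s
  proof -
    show "g \<otimes> s \<otimes> inv g \<in> ?L"
      using that S(2) by (intro normal_invE(2)[OF Ln]) auto
    show "(g \<otimes> s \<otimes> inv g) [^] (p ^ c) = \<one>"
      using that SG S1 by (simp add: conj_pow subset_eq)
  qed
  ultimately have "g \<otimes> s \<otimes> inv g \<in> S" if "g \<in> carrier G" "s \<in> S" for g s
    using that by blast
  then have "S \<lhd> G"
    using S(1) by (simp add: normal_inv_iff)
  then have "S = {\<one>}"
    using card_S by (intro triv) (auto simp: normal_p_subgroup_def)
  then have "card ?L = card ?M"
    using card_S c by simp
  then show ?thesis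
    using finL LM card_subset_eq by metis
qed

section \<open>Induction along the series\<close>

text \<open>The witness D starts as G, is kept at a p-factor, and is cut down at a q-factor to the
  centralizer of that factor; each such cut is paid for by a gamma. For H = G the conclusion makes D
  itself a p'-group, so that P \<inter> D is trivial. Commutation with p-elements is carried along
  because the p-factor step relies on it.\<close>

lemma exists_normal_commuting_p_elements:
  assumes fin: "finite (carrier G)" and solv: "solvable G" and p: "prime p"
    and triv: "\<And>S. normal_p_subgroup p S G \<Longrightarrow> S = {\<one>}"
    and P: "subgroup P G" "card P = p ^ s" and H: "H \<lhd> G"
  shows "\<exists>D m b. D \<lhd> G \<and> \<not> p dvd card (D \<inter> H) \<and>
    (\<forall>g\<in>D. \<forall>e. g [^] (p ^ e :: nat) = \<one> \<longrightarrow> (\<forall>x\<in>D \<inter> H. g \<otimes> x = x \<otimes> g)) \<and>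
    card H = p ^ b * m \<and> \<not> p dvd m \<and> card P dvd card (P \<inter> D) * big_gamma m"
  using H
proof (induction "card H" arbitrary: H rule: less_induct)
  case less
  note PG = subgroup.subset[OF P(1)]
  have Hs: "subgroup H G" using less.prems by (rule normal_imp_subgroup)
  note HG = subgroup.subset[OF Hs]
  have finH: "finite H" using HG fin by (rule finite_subset)
  show ?case
  proof (cases "H = {\<one>}")
    case True
    have "carrier G \<inter> H = {\<one>}" "P \<inter> carrier G = P"
      using True PG by auto
    \<comment> \<open>Witnesses D = G, m = 1, b = 0: no factor has been met yet, and Gamma(1) =
      1.\<close>
    then show ?thesis
      using p True
      by (intro exI[of _ "carrier G"] exI[of _ 1] exI[of _ 0]) (auto simp: normal_self)
  next
    case False
    then obtain K q a where K: "K \<lhd> G" "K \<subset> H" "card H = q ^ a * card K" and q: "prime q"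
      and HK: "\<And>x y. x \<in> H \<Longrightarrow> y \<in> H \<Longrightarrow> commutator x y \<in> K"
      using solvable_obtain_abelian_prime_power_section[OF fin solv less.prems] by metis
    have Ks: "subgroup K G" using K(1) by (rule normal_imp_subgroup)
    have "card K < card H"
      using K(2) finH by (rule_tac psubset_card_mono)
    from less.hyps[OF this K(1)] obtain D m b where D: "D \<lhd> G" and ndvd: "\<not> p dvd card (D \<inter> K)"
      and cent: "\<And>g x e. g \<in> D \<Longrightarrow> g [^] (p ^ e :: nat) = \<one> \<Longrightarrow> x \<in> D \<inter> K \<Longrightarrow> g \<otimes> x = x \<otimes> g"
      and m: "card K = p ^ b * m" "\<not> p dvd m" and dvd: "card P dvd card (P \<inter> D) * big_gamma m"
      by metis
    have Ds: "subgroup D G" using D by (rule normal_imp_subgroup)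
    show ?thesis
    proof (cases "q = p")
      case True
      \<comment> \<open>At a p-factor D and m stay as they are, and only the exponent b grows, by
        a.\<close>
      have "D \<inter> H = D \<inter> K"
      proof (rule Int_eq_Int_of_p_power_index[OF fin p _ D less.prems K(1), of a])
        show "K \<subseteq> H" "card H = p ^ a * card K" "\<not> p dvd card (D \<inter> K)"
          using K(2,3) True ndvd by auto
      qed (fact triv cent)+
      moreover have "card H = p ^ (a + b) * m"
        using K(3) m(1) True by (simp add: power_add)
      ultimately show ?thesis
        using D ndvd cent m(2) dvd by (intro exI[of _ D] exI[of _ m] exI[of _ "a + b"]) auto
    next
      case False
      define E where "E = section_centralizer D H K"
      have E: "E \<lhd> G" "E \<subseteq> D"
        using normal_section_centralizer[OF D less.prems K(1)] by (auto simp: E_def section_centralizer_def)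
      have Es: "subgroup E G" using E(1) by (rule normal_imp_subgroup)
      have EG: "E \<subseteq> carrier G" using Es by (rule subgroup.subset)
      have normK: "normalizes A K" and normH: "normalizes A H" if "A \<subseteq> carrier G" for A
        using K(1) less.prems that by (auto simp: normal_iff_normalizes intro: normalizes_subset)
      interpret KH: normal K "G\<lparr>carrier := H\<rparr>"
        using Ks Hs K(2) normK[OF HG] by (intro normal_in_subgroupI) auto
      have powK: "x [^] (q ^ a) \<in> K" if "x \<in> H" for x
        using KH.pow_index_mem[of x "q ^ a"] that finH K(3) by (simp add: order_def nat_pow_def)
      have cop: "coprime (p ^ e) (q ^ a)" for e
        using p q False by (simp add: primes_coprime)
      have DK: "subgroup (D \<inter> K) G" "subgroup (E \<inter> H) G"
        using Ds Ks Es Hs by (auto intro: subgroups_Inter_pair)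
      \<comment> \<open>An element x of order p in E \<inter> H has both x^p and x^(q^a) in K, so it
        lies in D \<inter> K, whose order is prime to p.\<close>
      have "\<not> p dvd card (E \<inter> H)"
      proof
        assume "p dvd card (E \<inter> H)"
        then obtain x where x: "x \<in> E" "x \<in> H" "x \<noteq> \<one>" "x [^] p = \<one>"
          using group.cauchy[OF subgroup_imp_group[OF DK(2)] _ p] finH by (auto simp: order_def nat_pow_def)
        have xG: "x \<in> carrier G" using x EG by auto
        have "x \<in> K"
        proof (rule pow_coprime_mem[OF Ks xG _ powK[OF x(2)]])
          show "x [^] p \<in> K" using x(4) subgroup.one_closed[OF Ks] by simp
          show "coprime p (q ^ a)" using cop[of 1] by simp
        qed
        then have "x [^] card (D \<inter> K) = \<one>"
          using x(1) E(2) by (intro subgroup_pow_card_eq_one[OF DK(1)]) auto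
        then show False
          using eq_one_of_coprime_pow[OF xG x(4)] x(3) prime_imp_coprime[OF p ndvd] by blast
      qed
      \<comment> \<open>Coprime action over the trivial subgroup: [g, x] lies in E and in K, hence
        in D \<inter> K, which the p-element g centralizes and whose order is prime to p.\<close>
      moreover have "g \<otimes> x = x \<otimes> g" if g: "g \<in> E" "g [^] (p ^ e :: nat) = \<one>" and x: "x \<in> E \<inter> H" for g e x
      proof -
        have carr: "g \<in> carrier G" "x \<in> carrier G" using g x EG by auto
        have "commutator g x \<in> {\<one>}"
        proof (rule commutator_mem_of_coprime[OF triv_subgroup DK(1) carr(1) g(2) carr(2)])
          show "normalizes {g} {\<one>}"
            using carr by (simp add: normalizes_def)
          show "commutator g y \<in> {\<one>}" if "y \<in> D \<inter> K" for y
            using cent[OF _ g(2) that] g(1) E(2) carr that subgroup.mem_carrier[OF DK(1)]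
            by (auto simp: commutator_eq_one_iff)
          have "g \<otimes> x \<otimes> inv g \<in> E"
            using g(1) x subgroup.m_closed[OF Es] subgroup.m_inv_closed[OF Es] by blast
          then have "commutator g x \<in> E"
            using x subgroup.m_closed[OF Es] subgroup.m_inv_closed[OF Es] by blast
          moreover have "commutator g x \<in> K"
            using g(1) x by (auto simp: E_def section_centralizer_def)
          ultimately show *: "commutator g x \<in> D \<inter> K"
            using E(2) by blast
          show "commutator g x [^] card (D \<inter> K) \<in> {\<one>}"
            using subgroup_pow_card_eq_one[OF DK(1) *] by simp
          show "coprime (p ^ e) (card (D \<inter> K))"
            using p ndvd by (simp add: prime_imp_coprime)
        qed
        then show ?thesis
          using carr by (simp add: commutator_eq_one_iff)
      qed
      \<comment> \<open>The p-group P \<inter> D acts on H/K with kernel P \<inter> E, so replacing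
        D by E costs at most gamma(a, q), which Gamma(m q^a) absorbs.\<close>
      moreover have "card P dvd card (P \<inter> E) * big_gamma (m * q ^ a)"
      proof -
        have PD: "subgroup (P \<inter> D) G"
          using P(1) Ds by (rule subgroups_Inter_pair)
        have PDG: "P \<inter> D \<subseteq> carrier G" using PG by blast
        obtain k where "card (P \<inter> D) = p ^ k"
          using subgroup_card_dvd[OF PD P(1)] P(2) divides_primepow_nat[OF p] by auto
        then have "card (P \<inter> D) dvd card (section_centralizer (P \<inter> D) H K) * small_gamma a q"
          using K(2,3) HK normK[OF PDG] normH[OF PDG] False
          by (intro card_dvd_section_centralizer_small_gamma[OF fin p q _ Hs Ks _ _ _ PD]) auto
        moreover have "section_centralizer (P \<inter> D) H K = P \<inter> E"
          by (auto simp: E_def section_centralizer_def)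
        ultimately have "card (P \<inter> D) * big_gamma m dvd card (P \<inter> E) * small_gamma a q * big_gamma m"
          by (simp add: mult_dvd_mono)
        with dvd have "card P dvd card (P \<inter> E) * (big_gamma m * small_gamma a q)"
          by (metis dvd_trans mult.assoc mult.commute)
        moreover have "m > 0" using m(2) by (cases m) auto
        ultimately show ?thesis
          using big_gamma_mult_prime_power_dvd[OF q, of m a] by (meson dvd_refl dvd_trans mult_dvd_mono)
      qed
      moreover have "card H = p ^ b * (m * q ^ a)"
        using K(3) m(1) by simp
      moreover have "\<not> p dvd m * q ^ a"
        using p q False m(2) by (metis prime_dvd_mult_iff prime_dvd_power primes_dvd_imp_eq)
      ultimately show ?thesis
        using E(1) by blast
    qed
  qed
qed

end

theorem theorem2p3:
  fixes G :: "('a, 'b) monoid_scheme" and p n s m :: nat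
  assumes "prime p"
    and "n = p ^ s * m"
    and "m \<ge> 1"
    and "\<not> p dvd m"
    and "group G"
    and "order G = n"
    and "\<not> p ^ s dvd big_gamma m"
  shows "p_core p G \<noteq> {\<one>\<^bsub>G\<^esub>} \<or> \<not> solvable G"
proof (rule ccontr)
  assume "\<not> ?thesis"
  then have core: "p_core p G = {\<one>\<^bsub>G\<^esub>}" and solv: "solvable G"
    by auto
  interpret group G by fact
  note p = assms(1)
  have "order G > 0"
    using assms by (simp add: prime_gt_0_nat)
  then have fin: "finite (carrier G)"
    by (simp add: order_gt_0_iff_finite)
  \<comment> \<open>Every normal p-subgroup lies in the p-core, which is assumed trivial
    here.\<close>
  have triv: "S = {\<one>\<^bsub>G\<^esub>}" if "normal_p_subgroup p S G" for S
    using p_core_greatest[OF fin p] that core subgroup.one_closed[of S G]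
    by (auto simp: normal_p_subgroup_def dest: normal_imp_subgroup)
  obtain P where P: "subgroup P G" "card P = p ^ s"
    using sylow_thm[OF p is_group _ fin] assms(2,6) by blast
  obtain D m' b where D: "D \<lhd> G" "\<not> p dvd card (D \<inter> carrier G)"
    and m': "card (carrier G) = p ^ b * m'" "\<not> p dvd m'"
    and dvd: "card P dvd card (P \<inter> D) * big_gamma m'"
    using exists_normal_commuting_p_elements[OF fin solv p triv P normal_self] by metis
  have Ds: "subgroup D G" using D(1) by (rule normal_imp_subgroup)
  have "p ^ b * m' = p ^ s * m"
    using m'(1) assms(2,6) by (simp add: order_def)
  \<comment> \<open>Comparing exponents of p identifies b with s, and cancelling the power of p then
    identifies m' with m.\<close>
  then have "multiplicity p (p ^ b * m') = multiplicity p (p ^ s * m)"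
    by simp
  moreover have "multiplicity p (p ^ i * j) = i" if "\<not> p dvd j" for i j
  proof -
    have "j \<noteq> 0" using that by (cases "j = 0") simp_all
    then show ?thesis
      using p that by (simp add: prime_elem_multiplicity_mult_distrib not_dvd_imp_multiplicity_0)
  qed
  ultimately have "b = s"
    using m'(2) assms(4) by metis
  then have "m' = m"
    using \<open>p ^ b * m' = p ^ s * m\<close> p by (simp add: prime_gt_0_nat)
  have PD: "subgroup (P \<inter> D) G"
    using P(1) Ds by (rule subgroups_Inter_pair)
  have "D \<inter> carrier G = D"
    using subgroup.subset[OF Ds] by blast
  \<comment> \<open>P \<inter> D is a p-group inside the p'-group D, hence trivial; so p^s = |P|
    divides Gamma(m), against the hypothesis.\<close>
  then have "card (P \<inter> D) dvd p ^ s" "\<not> p dvd card (P \<inter> D)"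
    using subgroup_card_dvd[OF PD P(1)] subgroup_card_dvd[OF PD Ds] D(2) P(2) by (auto dest: dvd_trans)
  then have "card (P \<inter> D) = 1"
    using divides_primepow_nat[OF p] by (metis dvd_triv_left power_0 power_eq_if)
  then show False
    using dvd P(2) \<open>m' = m\<close> assms(7) by simp
qed

end
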